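(* Let $2\le p\le\infty$ and $X=\ell_p$. There exists a symmetric and convex compact set $K\subset X$ such that the greedy algorithm applied to $K$ satisfies $$\sigma_n(K)_X\eqsim n^{1-\frac1p}\,\varepsilon_n(K)_X ,$$ i.e. there are constants $c,C>0$ independent of $n$ with $c\,n^{1-1/p}\varepsilon_n(K)_X\le\sigma_n(K)_X\le C\,n^{1-1/p}\varepsilon_n(K)_X$ for all $n\ge1$.
   Context: $\ell_p$ is the usual Banach space of real sequences, with $1/p=0$ for $p=\infty$. For a subspace $U\subset X$ and $f\in X$, $\mathrm{dist}(f,U)=\inf_{g\in U}\|f-g\|_X$. Greedy algorithm: set $X_0=\{0\}$; for $n=1,2,\dots$ choose $f_n\in\arg\max_{f\in K}\mathrm{dist}(f,X_{n-1})$ and set $X_n=\mathrm{span}\{f_1,\dots,f_n\}$. Its error is $\sigma_n(K)_X:=\sup_{f\in K}\mathrm{dist}(f,X_n)$. (Dyadic) entropy numbers: $\varepsilon_n(K)_X=\inf\{\varepsilon>0:\ K\text{ is covered by }2^n\text{ balls of }X\text{ of radius }\varepsilon\}$. *)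

theory Defs
  imports "HOL-Analysis.Analysis" "HOL-Library.Function_Algebras"
begin

section \<open>Real sequences as a vector space\<close>

text \<open>With this instance the library notions \<^term>\<open>span\<close>, \<^term>\<open>convex\<close> and
  \<^term>\<open>subspace\<close> are available for sequences \<^typ>\<open>nat \<Rightarrow> real\<close>.\<close>

instantiation "fun" :: (type, real_vector) real_vector
begin

definition scaleR_fun :: "real \<Rightarrow> ('a \<Rightarrow> 'b) \<Rightarrow> 'a \<Rightarrow> 'b" where
  "scaleR_fun c x = (\<lambda>k. c *\<^sub>R x k)"

instance
  by standard (auto simp: scaleR_fun_def plus_fun_def scaleR_add_right scaleR_add_left)

end


section \<open>The sequence spaces\<close>

text \<open>\<^term>\<open>p\<close> ranges over the extended reals and is meant to satisfy \<open>1 \<le> p \<le> \<infinity>\<close>.\<close>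

definition ell :: "ereal \<Rightarrow> (nat \<Rightarrow> real) set" where
  "ell p = {x. if p = \<infinity> then bounded (range x)
               else summable (\<lambda>k. \<bar>x k\<bar> powr real_of_ereal p)}"

text \<open>The value \<open>0\<close> outside the space is a dummy; it makes the distance below nonnegative on all
  sequences, as the locale \<^locale>\<open>Metric_space\<close> requires.\<close>

definition ell_norm :: "ereal \<Rightarrow> (nat \<Rightarrow> real) \<Rightarrow> real" where
  "ell_norm p x =
     (if x \<notin> ell p then 0
      else if p = \<infinity> then (SUP k. \<bar>x k\<bar>)
      else (\<Sum>k. \<bar>x k\<bar> powr real_of_ereal p) powr (1 / real_of_ereal p))"

definition ell_dist :: "ereal \<Rightarrow> (nat \<Rightarrow> real) \<Rightarrow> (nat \<Rightarrow> real) \<Rightarrow> real" where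
  "ell_dist p x y = ell_norm p (x - y)"

definition ell_topology :: "ereal \<Rightarrow> (nat \<Rightarrow> real) topology" where
  "ell_topology p = Metric_space.mtopology (ell p) (ell_dist p)"


section \<open>Distance to a subspace, greedy algorithm, entropy numbers\<close>

definition ell_infdist :: "ereal \<Rightarrow> (nat \<Rightarrow> real) \<Rightarrow> (nat \<Rightarrow> real) set \<Rightarrow> real" where
  "ell_infdist p f U = (INF g\<in>U. ell_dist p f g)"

text \<open>A maximizer need not be unique, so the greedy algorithm is the set of all its possible runs
  \<open>f 1, f 2, \<dots>\<close>. The value \<open>f 0\<close> is not used, and \<open>greedy_space f 0 = {0}\<close>.\<close>

definition greedy_space :: "(nat \<Rightarrow> nat \<Rightarrow> real) \<Rightarrow> nat \<Rightarrow> (nat \<Rightarrow> real) set" where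
  "greedy_space f n = span (f ` {1..n})"

definition greedy_run :: "ereal \<Rightarrow> (nat \<Rightarrow> real) set \<Rightarrow> (nat \<Rightarrow> nat \<Rightarrow> real) \<Rightarrow> bool" where
  "greedy_run p K f \<longleftrightarrow>
     (\<forall>n\<ge>1. is_arg_max (\<lambda>g. ell_infdist p g (greedy_space f (n - 1))) (\<lambda>g. g \<in> K) (f n))"

definition greedy_error ::
    "ereal \<Rightarrow> (nat \<Rightarrow> real) set \<Rightarrow> (nat \<Rightarrow> nat \<Rightarrow> real) \<Rightarrow> nat \<Rightarrow> real" where
  "greedy_error p K f n = (SUP g\<in>K. ell_infdist p g (greedy_space f n))"

definition entropy_number :: "ereal \<Rightarrow> (nat \<Rightarrow> real) set \<Rightarrow> nat \<Rightarrow> real" where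
  "entropy_number p K n =
     Inf {\<epsilon>. \<epsilon> > 0 \<and> (\<exists>c. (\<forall>i<2^n. c i \<in> ell p) \<and>
                         K \<subseteq> (\<Union>i<(2::nat)^n. Metric_space.mcball (ell p) (ell_dist p) (c i) \<epsilon>))}"


section \<open>The sequence spaces are metric spaces\<close>

lemma powr_convex_ineq:
  fixes u v t q :: real
  assumes q: "1 \<le> q" and u: "0 \<le> u" and v: "0 \<le> v" and t: "0 \<le> t" "t \<le> 1"
  shows "(t * u + (1 - t) * v) powr q \<le> t * u powr q + (1 - t) * v powr q"
proof -
  have le: "(s * w) powr q \<le> s * w powr q" if "0 \<le> s" "s \<le> 1" "0 \<le> w" for s w :: real
  proof (cases "s = 0")
    case False
    then have "s powr q \<le> s powr 1"
      using that q by (intro powr_mono') auto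
    then show ?thesis
      using that by (simp add: powr_mult mult_right_mono)
  qed simp
  consider "u = 0" | "v = 0" | "u > 0" "v > 0"
    using u v by linarith
  then show ?thesis
  proof cases
    case 1
    then show ?thesis using le[of "1 - t" v] t v by simp
  next
    case 2
    then show ?thesis using le[of t u] t u by simp
  next
    case 3
    then show ?thesis
      using convex_onD[OF powr_convex[OF q], of "1 - t" u v] t by simp
  qed
qed

lemma ereal_exponent_cases:
  assumes "1 \<le> p"
  obtains "p = \<infinity>" | q where "p = ereal q" "1 \<le> q"
  using assms by (cases p) auto

lemma ell_norm_nonneg: "0 \<le> ell_norm p x"
proof (cases "x \<in> ell p \<and> p = \<infinity>")
  case True
  then have "bdd_above (range (\<lambda>k. \<bar>x k\<bar>))"
    by (auto simp: ell_def bounded_iff bdd_above_def)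
  then have "\<bar>x 0\<bar> \<le> (SUP k. \<bar>x k\<bar>)"
    by (rule cSUP_upper2) auto
  with True show ?thesis
    by (auto simp: ell_norm_def)
qed (auto simp: ell_norm_def)

lemma ell_norm_uminus: "ell_norm p (- x) = ell_norm p x"
  by (auto simp: ell_norm_def ell_def bounded_iff)

lemma ell_zero: "1 \<le> p \<Longrightarrow> 0 \<in> ell p" "1 \<le> p \<Longrightarrow> ell_norm p 0 = 0"
  by (auto simp: ell_def ell_norm_def bounded_iff elim!: ereal_exponent_cases)

lemma ell_norm_eq_0_D:
  assumes p: "1 \<le> p" and x: "x \<in> ell p" and 0: "ell_norm p x = 0"
  shows "x = 0"
  using p
proof (cases rule: ereal_exponent_cases)
  case 1
  then have "bdd_above (range (\<lambda>k. \<bar>x k\<bar>))"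
    using x by (auto simp: ell_def bounded_iff bdd_above_def)
  then have "\<bar>x k\<bar> \<le> (SUP k. \<bar>x k\<bar>)" for k
    by (rule cSUP_upper[rotated]) auto
  with 0 x 1 show ?thesis
    by (auto simp: ell_norm_def zero_fun_def)
next
  case (2 q)
  have s: "summable (\<lambda>k. \<bar>x k\<bar> powr q)" and z: "(\<Sum>k. \<bar>x k\<bar> powr q) = 0"
    using x 0 2 by (auto simp: ell_def ell_norm_def)
  have "\<bar>x k\<bar> powr q = 0" for k
    using suminf_eq_zero_iff[OF s] z by simp
  then show ?thesis by (auto simp: zero_fun_def)
qed

lemma ell_triangle:
  assumes p: "1 \<le> p" and x: "x \<in> ell p" and y: "y \<in> ell p"
  shows "x + y \<in> ell p \<and> ell_norm p (x + y) \<le> ell_norm p x + ell_norm p y"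
proof -
  consider "p = \<infinity>" | "ell_norm p x = 0 \<or> ell_norm p y = 0"
    | q where "p = ereal q" "1 \<le> q" "ell_norm p x > 0" "ell_norm p y > 0"
    using p ell_norm_nonneg[of p x] ell_norm_nonneg[of p y]
    by (metis ereal_exponent_cases order_le_less)
  then show ?thesis
  proof cases
    case 1
    have bx: "bounded (range x)" and b_y: "bounded (range y)"
      using x y 1 by (auto simp: ell_def)
    have bdd: "bdd_above (range (\<lambda>k. \<bar>x k\<bar>))" "bdd_above (range (\<lambda>k. \<bar>y k\<bar>))"
      using bx b_y by (auto simp: bounded_iff bdd_above_def)
    have le: "\<bar>x k + y k\<bar> \<le> (SUP k. \<bar>x k\<bar>) + (SUP k. \<bar>y k\<bar>)" for k
      using cSUP_upper[OF UNIV_I bdd(1), of k] cSUP_upper[OF UNIV_I bdd(2), of k] by linarith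
    then have "bounded (range (x + y))"
      by (force simp: bounded_iff)
    moreover have "(SUP k. \<bar>x k + y k\<bar>) \<le> (SUP k. \<bar>x k\<bar>) + (SUP k. \<bar>y k\<bar>)"
      by (rule cSUP_least) (use le in auto)
    ultimately show ?thesis
      using x y 1 by (auto simp: ell_norm_def ell_def)
  next
    case 2
    then have "x = 0 \<or> y = 0"
      using p x y ell_norm_eq_0_D by blast
    then show ?thesis
      using x y p by (auto simp: ell_zero)
  next
    case (3 q)
    define a b where "a = ell_norm p x" and "b = ell_norm p y"
    define t where "t = a / (a + b)"
    have ab: "a > 0" "b > 0" using 3 by (auto simp: a_def b_def)
    have t: "0 \<le> t" "t \<le> 1" "1 - t = b / (a + b)"
      using ab by (auto simp: t_def field_simps)
    have sx: "summable (\<lambda>k. \<bar>x k\<bar> powr q)" and sy: "summable (\<lambda>k. \<bar>y k\<bar> powr q)"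
      using x y 3 by (auto simp: ell_def)
    have a_q: "(\<Sum>k. \<bar>x k\<bar> powr q) = a powr q" and b_q: "(\<Sum>k. \<bar>y k\<bar> powr q) = b powr q"
      using x y 3 by (auto simp: a_def b_def ell_norm_def powr_powr suminf_nonneg sx sy)
    define h where "h k = (a + b) powr q *
        (t / a powr q * \<bar>x k\<bar> powr q + (1 - t) / b powr q * \<bar>y k\<bar> powr q)" for k
    have "(\<lambda>k. \<bar>x k\<bar> powr q) sums (a powr q)" "(\<lambda>k. \<bar>y k\<bar> powr q) sums (b powr q)"
      using summable_sums[OF sx] summable_sums[OF sy] a_q b_q by simp_all
    then have "h sums ((a + b) powr q * (t / a powr q * a powr q + (1 - t) / b powr q * b powr q))"
      unfolding h_def by (intro sums_mult sums_add)
    then have "h sums ((a + b) powr q)"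
      using ab by simp
    then have sh: "summable h" and suminf_h: "suminf h = (a + b) powr q"
      by (auto simp: sums_iff)
    have le: "\<bar>x k + y k\<bar> powr q \<le> h k" for k
    proof -
      have "\<bar>x k + y k\<bar> \<le> \<bar>x k\<bar> + \<bar>y k\<bar>" by simp
      also have "\<dots> = (a + b) * (t * (\<bar>x k\<bar> / a) + (1 - t) * (\<bar>y k\<bar> / b))"
      proof -
        have "(a + b) * t = a" "(a + b) * (1 - t) = b"
          unfolding t(3) unfolding t_def using ab by simp_all
        then have "(a + b) * (t * (\<bar>x k\<bar> / a) + (1 - t) * (\<bar>y k\<bar> / b))
            = a * (\<bar>x k\<bar> / a) + b * (\<bar>y k\<bar> / b)"
          by (metis distrib_left mult.assoc)
        then show ?thesis using ab by simp
      qed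
      finally have "\<bar>x k + y k\<bar> powr q
          \<le> ((a + b) * (t * (\<bar>x k\<bar> / a) + (1 - t) * (\<bar>y k\<bar> / b))) powr q"
        using 3 by (intro powr_mono2) auto
      also have "\<dots> = (a + b) powr q * (t * (\<bar>x k\<bar> / a) + (1 - t) * (\<bar>y k\<bar> / b)) powr q"
        using ab t by (simp add: powr_mult)
      also have "\<dots> \<le> (a + b) powr q *
          (t * (\<bar>x k\<bar> / a) powr q + (1 - t) * (\<bar>y k\<bar> / b) powr q)"
        using 3 ab t by (intro mult_left_mono powr_convex_ineq) auto
      also have "\<dots> = h k"
        using ab by (simp add: h_def powr_divide)
      finally show ?thesis .
    qed
    have sxy: "summable (\<lambda>k. \<bar>x k + y k\<bar> powr q)"
      by (rule summable_comparison_test'[OF sh, of 0]) (use le in auto)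
    have "(\<Sum>k. \<bar>x k + y k\<bar> powr q) \<le> (a + b) powr q"
      using suminf_le[OF le sxy sh] suminf_h by simp
    then have "(\<Sum>k. \<bar>x k + y k\<bar> powr q) powr (1 / q) \<le> ((a + b) powr q) powr (1 / q)"
      using 3 sxy by (intro powr_mono2) (auto intro: suminf_nonneg)
    also have "\<dots> = a + b"
      using 3 ab by (simp add: powr_powr)
    finally have le_ab: "(\<Sum>k. \<bar>x k + y k\<bar> powr q) powr (1 / q) \<le> a + b" .
    have mem: "x + y \<in> ell p"
      using sxy 3 by (auto simp: ell_def)
    then have "ell_norm p (x + y) = (\<Sum>k. \<bar>x k + y k\<bar> powr q) powr (1 / q)"
      using 3 by (auto simp: ell_norm_def)
    with le_ab mem show ?thesis
      by (simp add: a_def b_def)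
  qed
qed

lemma ell_uminus: "x \<in> ell p \<Longrightarrow> - x \<in> ell p"
  by (auto simp: ell_def bounded_iff)

lemma Metric_space_ell:
  assumes p: "1 \<le> p"
  shows "Metric_space (ell p) (ell_dist p)"
proof
  fix x y z :: "nat \<Rightarrow> real"
  show "0 \<le> ell_dist p x y"
    by (simp add: ell_dist_def ell_norm_nonneg)
  show "ell_dist p x y = ell_dist p y x"
    using ell_norm_uminus[of p "x - y"] by (simp add: ell_dist_def)
  assume x: "x \<in> ell p" and y: "y \<in> ell p"
  have diff: "u - v \<in> ell p" if "u \<in> ell p" "v \<in> ell p" for u v
    using ell_triangle[OF p that(1) ell_uminus[OF that(2)]] by simp
  show "ell_dist p x y = 0 \<longleftrightarrow> x = y"
    using ell_norm_eq_0_D[OF p diff[OF x y]] ell_zero[OF p] by (auto simp: ell_dist_def)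
  assume z: "z \<in> ell p"
  show "ell_dist p x z \<le> ell_dist p x y + ell_dist p y z"
    using ell_triangle[OF p diff[OF x y] diff[OF y z]] by (simp add: ell_dist_def)
qed

lemma subspace_ell:
  assumes p: "1 \<le> p"
  shows "subspace (ell p)"
proof (rule subspaceI)
  show "0 \<in> ell p" using p by (rule ell_zero)
next
  fix x y assume "x \<in> ell p" "y \<in> ell p"
  then show "x + y \<in> ell p" using ell_triangle[OF p] by blast
next
  fix c x assume x: "x \<in> ell p"
  from p show "c *\<^sub>R x \<in> ell p"
  proof (cases rule: ereal_exponent_cases)
    case 1
    then obtain B where "\<And>k. \<bar>x k\<bar> \<le> B"
      using x by (auto simp: ell_def bounded_iff)
    then have "\<And>k. \<bar>c * x k\<bar> \<le> \<bar>c\<bar> * B"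
      by (simp add: abs_mult mult_left_mono)
    then show ?thesis
      using 1 by (auto simp: ell_def bounded_iff scaleR_fun_def)
  next
    case (2 q)
    then show ?thesis
      using x by (auto simp: ell_def scaleR_fun_def abs_mult powr_mult intro: summable_mult)
  qed
qed

end

theory Submission
  imports Defs
begin

text \<open>The set is the weighted octahedron \<open>{x. \<Sum>k. (k + 1) \<bar>x k\<bar> \<le> 1}\<close>, which is the same for all \<open>p\<close>. The
  maximum over it of the norm of the tail from coordinate \<open>n\<close> on is \<open>1 / (n + 1)\<close>, attained only at
  the two vertices on the \<open>n\<close>-th axis. So up to signs there is only one greedy run, its spaces are the
  coordinate subspaces, and \<open>\<sigma>\<^sub>n = 1 / (n + 1)\<close>.

  It remains to see that \<open>\<epsilon>\<^sub>n\<close> is of order \<open>n powr (1 / p - 2)\<close>. For the upper bound,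
  round to the grid of mesh \<open>h = 200 / n\<^sup>2\<close>: the rounded points are \<open>h\<close> times signed partitions of
  numbers up to \<open>1 / h\<close>, of which there are at most \<open>2 ^ n\<close>, as their number is exponential in the
  square root of \<open>1 / h\<close>. For the lower bound, the multiples by \<open>1 / (8 n)\<^sup>2\<close> of the 0-1 vectors of
  length \<open>8 n\<close> lie in the set, and a ball of too small radius contains only such vectors that pairwise
  differ in fewer than \<open>n\<close> places.\<close>

section \<open>Norm estimates in the sequence spaces\<close>

text \<open>Interpolation between the sup norm and the sum norm: for finite \<open>q\<close>,
  \<open>\<bar>x k\<bar> powr q\<close> is at most \<open>h powr (q - 1) * \<bar>x k\<bar>\<close>,
  and the latter is summed. Bounding partial sums yields membership together with the
  estimate.\<close>

lemma ell_norm_interpolation: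
  assumes p: "1 \<le> p" and h: "0 < h" and S: "0 < S"
    and le_h: "\<And>k. \<bar>x k\<bar> \<le> h" and le_S: "\<And>n. (\<Sum>k<n. \<bar>x k\<bar>) \<le> S"
  shows "x \<in> ell p" "ell_norm p x \<le> h powr (1 - real_of_ereal (1 / p)) * S powr real_of_ereal (1 / p)"
proof -
  have "x \<in> ell p \<and> ell_norm p x \<le> h powr (1 - real_of_ereal (1 / p)) * S powr real_of_ereal (1 / p)"
    using p
  proof (cases rule: ereal_exponent_cases)
    case 1
    then have x: "x \<in> ell p"
      using le_h by (auto simp: ell_def bounded_iff)
    have "(SUP k. \<bar>x k\<bar>) \<le> h"
      using le_h by (intro cSUP_least) auto
    with x 1 h S show ?thesis
      by (simp add: ell_norm_def)
  next
    case (2 q)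
    have le: "\<bar>x k\<bar> powr q \<le> h powr (q - 1) * \<bar>x k\<bar>" for k
    proof (cases "x k = 0")
      case False
      then have "\<bar>x k\<bar> powr q = \<bar>x k\<bar> powr (q - 1) * \<bar>x k\<bar>"
        by (simp add: powr_diff)
      also have "\<dots> \<le> h powr (q - 1) * \<bar>x k\<bar>"
        using 2 le_h by (intro mult_right_mono powr_mono2) auto
      finally show ?thesis .
    qed simp
    have "(\<Sum>k\<le>n. \<bar>x k\<bar>) \<le> S" for n
      using le_S[of "Suc n"] by (simp only: lessThan_Suc_atMost)
    then have sx: "summable (\<lambda>k. \<bar>x k\<bar>)"
      by (intro bounded_imp_summable[where B = S]) auto
    have s: "summable (\<lambda>k. \<bar>x k\<bar> powr q)"
      by (rule summable_comparison_test'[OF summable_mult[OF sx, of "h powr (q - 1)"], of 0])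
        (use le in auto)
    have "(\<Sum>k. \<bar>x k\<bar> powr q) \<le> h powr (q - 1) * (\<Sum>k. \<bar>x k\<bar>)"
      using suminf_le[OF le s summable_mult[OF sx]] suminf_mult[OF sx] by simp
    also have "\<dots> \<le> h powr (q - 1) * S"
      using suminf_le_const[OF sx le_S] by (intro mult_left_mono) auto
    finally have "(\<Sum>k. \<bar>x k\<bar> powr q) powr (1 / q) \<le> (h powr (q - 1) * S) powr (1 / q)"
      using 2 s by (intro powr_mono2) (auto intro: suminf_nonneg)
    also have "\<dots> = h powr (1 - 1 / q) * S powr (1 / q)"
      using 2 h S by (simp add: powr_mult powr_powr diff_divide_distrib)
    finally show ?thesis
      using s 2 by (auto simp: ell_norm_def ell_def one_ereal_def)
  qed
  then show "x \<in> ell p" "ell_norm p x \<le> h powr (1 - real_of_ereal (1 / p)) * S powr real_of_ereal (1 / p)"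
    by auto
qed

text \<open>The case \<open>h = S\<close>: a single entry is at most the sum, and the two exponents
  add up to 1.\<close>

lemma ell_norm_le_sum_abs:
  assumes p: "1 \<le> p" and S: "0 < S" and le_S: "\<And>n. (\<Sum>k<n. \<bar>x k\<bar>) \<le> S"
  shows "x \<in> ell p" "ell_norm p x \<le> S"
proof -
  have le: "\<bar>x k\<bar> \<le> S" for k
  proof -
    have "\<bar>x k\<bar> \<le> (\<Sum>k<Suc k. \<bar>x k\<bar>)"
      by (simp add: sum_nonneg)
    also have "\<dots> \<le> S" by (rule le_S)
    finally show ?thesis .
  qed
  show "x \<in> ell p"
    by (rule ell_norm_interpolation(1)[OF p S S le le_S])
  show "ell_norm p x \<le> S"
    using ell_norm_interpolation(2)[OF p S S le le_S] S by (simp flip: powr_add)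
qed

text \<open>Membership of \<open>y\<close> excludes the dummy norm 0 of sequences outside the
  space.\<close>

lemma ell_norm_mono:
  assumes p: "1 \<le> p" and y: "y \<in> ell p" and le: "\<And>k. \<bar>x k\<bar> \<le> \<bar>y k\<bar>"
  shows "ell_norm p x \<le> ell_norm p y"
  using p
proof (cases rule: ereal_exponent_cases)
  case 1
  then have bdd: "bdd_above (range (\<lambda>k. \<bar>y k\<bar>))"
    using y by (auto simp: ell_def bounded_iff bdd_above_def)
  have "x \<in> ell p"
    using y le 1 unfolding ell_def bounded_iff by simp (meson order_trans)
  moreover have "(SUP k. \<bar>x k\<bar>) \<le> (SUP k. \<bar>y k\<bar>)"
    by (rule cSUP_mono[OF _ bdd]) (use le in auto)
  ultimately show ?thesis
    using 1 y by (simp add: ell_norm_def)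
next
  case (2 q)
  have le': "\<bar>x k\<bar> powr q \<le> \<bar>y k\<bar> powr q" for k
    using le 2 by (intro powr_mono2) auto
  have sy: "summable (\<lambda>k. \<bar>y k\<bar> powr q)"
    using y 2 by (auto simp: ell_def)
  have sx: "summable (\<lambda>k. \<bar>x k\<bar> powr q)"
    by (rule summable_comparison_test'[OF sy, of 0]) (use le' in auto)
  have "(\<Sum>k. \<bar>x k\<bar> powr q) powr (1 / q) \<le> (\<Sum>k. \<bar>y k\<bar> powr q) powr (1 / q)"
    using 2 by (intro powr_mono2 suminf_le le' sx sy suminf_nonneg) auto
  then show ?thesis
    using 2 sx sy by (auto simp: ell_norm_def ell_def)
qed

text \<open>Only the coordinates in \<open>A\<close> are counted. For infinite \<open>p\<close> the
  power of the cardinality is 1, and one coordinate of \<open>A\<close> suffices.\<close>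

lemma ell_norm_ge:
  assumes p: "1 \<le> p" and x: "x \<in> ell p" and t: "0 < t"
    and A: "finite A" "A \<noteq> {}" and ge: "\<And>k. k \<in> A \<Longrightarrow> t \<le> \<bar>x k\<bar>"
  shows "t * real (card A) powr real_of_ereal (1 / p) \<le> ell_norm p x"
  using p
proof (cases rule: ereal_exponent_cases)
  case 1
  then have bdd: "bdd_above (range (\<lambda>k. \<bar>x k\<bar>))"
    using x by (auto simp: ell_def bounded_iff bdd_above_def)
  obtain k where "k \<in> A" using A by auto
  then have "t \<le> (SUP k. \<bar>x k\<bar>)"
    using cSUP_upper2[OF bdd UNIV_I] ge by blast
  then show ?thesis
    using 1 x A by (simp add: ell_norm_def)
next
  case (2 q)
  have s: "summable (\<lambda>k. \<bar>x k\<bar> powr q)"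
    using x 2 by (auto simp: ell_def)
  have "real (card A) * t powr q = (\<Sum>k\<in>A. t powr q)"
    by simp
  also have "\<dots> \<le> (\<Sum>k\<in>A. \<bar>x k\<bar> powr q)"
    using 2 t ge by (intro sum_mono powr_mono2) auto
  also have "\<dots> \<le> (\<Sum>k. \<bar>x k\<bar> powr q)"
    using s A by (intro sum_le_suminf) auto
  finally have "(real (card A) * t powr q) powr (1 / q) \<le> (\<Sum>k. \<bar>x k\<bar> powr q) powr (1 / q)"
    using 2 by (intro powr_mono2) auto
  then show ?thesis
    using 2 x t by (simp add: ell_norm_def one_ereal_def powr_mult powr_powr mult.commute)
qed

lemma ell_diff: "1 \<le> p \<Longrightarrow> x \<in> ell p \<Longrightarrow> y \<in> ell p \<Longrightarrow> x - y \<in> ell p"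
  by (rule subspace_diff[OF subspace_ell])

section \<open>The weighted octahedron: convexity and compactness\<close>

text \<open>Partial sums avoid any summability condition, and each constraint involves finitely many
  coordinates, so it is closed for coordinatewise convergence.\<close>

definition octahedron :: "(nat \<Rightarrow> real) set" where
  "octahedron = {x. \<forall>n. (\<Sum>k<n. real (Suc k) * \<bar>x k\<bar>) \<le> 1}"

lemma octahedronD: "x \<in> octahedron \<Longrightarrow> (\<Sum>k<n. real (Suc k) * \<bar>x k\<bar>) \<le> 1"
  by (simp add: octahedron_def)

text \<open>From coordinate \<open>m\<close> on all weights are at least
  \<open>Suc m\<close>.\<close>

lemma octahedron_tail:
  assumes "x \<in> octahedron"
  shows "real (Suc m) * (\<Sum>k\<in>{m..<n}. \<bar>x k\<bar>) \<le> 1"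
proof -
  have "real (Suc m) * (\<Sum>k\<in>{m..<n}. \<bar>x k\<bar>) \<le> (\<Sum>k\<in>{m..<n}. real (Suc k) * \<bar>x k\<bar>)"
    unfolding sum_distrib_left by (intro sum_mono mult_right_mono) auto
  also have "\<dots> \<le> (\<Sum>k<n. real (Suc k) * \<bar>x k\<bar>)"
    by (intro sum_mono2) auto
  also have "\<dots> \<le> 1"
    using assms by (rule octahedronD)
  finally show ?thesis .
qed

lemma octahedron_tail':
  "x \<in> octahedron \<Longrightarrow> (\<Sum>k\<in>{m..<n}. \<bar>x k\<bar>) \<le> 1 / real (Suc m)"
  using octahedron_tail[of x m n] by (simp add: field_simps)

lemma octahedron_subset_ell:
  assumes "1 \<le> p"
  shows "octahedron \<subseteq> ell p"
proof
  fix x assume x: "x \<in> octahedron"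
  show "x \<in> ell p"
    by (rule ell_norm_le_sum_abs(1)[OF assms, of 1])
      (use octahedron_tail'[OF x, of 0] in \<open>auto simp: atLeast0LessThan\<close>)
qed

lemma octahedron_uminus: "x \<in> octahedron \<Longrightarrow> - x \<in> octahedron"
  by (simp add: octahedron_def)

lemma convex_octahedron: "convex octahedron"
proof (rule convexI)
  fix x y :: "nat \<Rightarrow> real" and u v :: real
  assume x: "x \<in> octahedron" and y: "y \<in> octahedron" and uv: "0 \<le> u" "0 \<le> v" "u + v = 1"
  show "u *\<^sub>R x + v *\<^sub>R y \<in> octahedron"
    unfolding octahedron_def
  proof (intro CollectI allI)
    fix n
    have "(\<Sum>k<n. real (Suc k) * \<bar>(u *\<^sub>R x + v *\<^sub>R y) k\<bar>)
        \<le> (\<Sum>k<n. u * (real (Suc k) * \<bar>x k\<bar>) + v * (real (Suc k) * \<bar>y k\<bar>))"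
    proof (rule sum_mono)
      fix k
      have "\<bar>u * x k + v * y k\<bar> \<le> u * \<bar>x k\<bar> + v * \<bar>y k\<bar>"
        using uv abs_triangle_ineq[of "u * x k" "v * y k"] by (simp add: abs_mult)
      from mult_left_mono[OF this, of "real (Suc k)"]
      show "real (Suc k) * \<bar>(u *\<^sub>R x + v *\<^sub>R y) k\<bar>
          \<le> u * (real (Suc k) * \<bar>x k\<bar>) + v * (real (Suc k) * \<bar>y k\<bar>)"
        by (simp add: scaleR_fun_def algebra_simps)
    qed
    also have "\<dots> = u * (\<Sum>k<n. real (Suc k) * \<bar>x k\<bar>) + v * (\<Sum>k<n. real (Suc k) * \<bar>y k\<bar>)"
      by (simp add: sum.distrib sum_distrib_left)
    also have "\<dots> \<le> u * 1 + v * 1"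
      using octahedronD[OF x] octahedronD[OF y] uv by (intro add_mono mult_left_mono) auto
    finally show "(\<Sum>k<n. real (Suc k) * \<bar>(u *\<^sub>R x + v *\<^sub>R y) k\<bar>) \<le> 1"
      using uv by simp
  qed
qed

text \<open>Here \<open>compact\<close> refers to the product topology on sequences; the octahedron
  is a closed subset of the cube with sides \<open>{-1..1}\<close>.\<close>

lemma compact_octahedron: "compact octahedron"
proof -
  have "compactin (product_topology (\<lambda>_. euclidean) UNIV) (PiE UNIV (\<lambda>_::nat. {-1..1::real}))"
    by (simp add: compactin_PiE)
  then have "compact (PiE UNIV (\<lambda>_::nat. {-1..1::real}))"
    by (simp add: euclidean_product_topology)
  moreover have "closed octahedron"
    unfolding octahedron_def
    by (intro closed_Collect_all closed_Collect_le continuous_intros continuous_on_product_coordinates)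
  moreover have "octahedron \<subseteq> PiE UNIV (\<lambda>_::nat. {-1..1::real})"
  proof
    fix x assume x: "x \<in> octahedron"
    have "\<bar>x k\<bar> \<le> 1" for k
      using octahedron_tail'[OF x, of k "Suc k"] order_trans[of _ "1 / real (Suc k)" 1] by simp
    then show "x \<in> PiE UNIV (\<lambda>_::nat. {-1..1::real})"
      by (auto simp: abs_le_iff minus_le_iff)
  qed
  ultimately show ?thesis
    by (metis compact_Int_closed inf.absorb_iff2)
qed

text \<open>The tails of both points from \<open>m\<close> on have sum at most
  \<open>1 / real (Suc m)\<close>, uniformly over the set, so closeness on finitely many coordinates
  forces closeness in norm.\<close>

lemma octahedron_dist_le:
  assumes p: "1 \<le> p" and x: "x \<in> octahedron" and y: "y \<in> octahedron"
    and s: "(\<Sum>k<m. \<bar>x k - y k\<bar>) \<le> s" "0 \<le> s"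
  shows "ell_dist p x y \<le> s + 2 / real (Suc m)"
  unfolding ell_dist_def
proof (rule ell_norm_le_sum_abs(2)[OF p])
  show "0 < s + 2 / real (Suc m)"
    using s by (simp add: add_nonneg_pos)
  fix n
  have "(\<Sum>k<n. \<bar>(x - y) k\<bar>) \<le> (\<Sum>k\<in>{..<m} \<union> {m..<n}. \<bar>x k - y k\<bar>)"
    by (auto intro!: sum_mono2)
  also have "\<dots> = (\<Sum>k<m. \<bar>x k - y k\<bar>) + (\<Sum>k\<in>{m..<n}. \<bar>x k - y k\<bar>)"
    by (rule sum.union_disjoint) auto
  also have "(\<Sum>k\<in>{m..<n}. \<bar>x k - y k\<bar>) \<le> (\<Sum>k\<in>{m..<n}. \<bar>x k\<bar> + \<bar>y k\<bar>)"
    by (rule sum_mono) simp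
  also have "\<dots> = (\<Sum>k\<in>{m..<n}. \<bar>x k\<bar>) + (\<Sum>k\<in>{m..<n}. \<bar>y k\<bar>)"
    by (rule sum.distrib)
  also have "\<dots> \<le> 1 / real (Suc m) + 1 / real (Suc m)"
    using octahedron_tail' x y by (intro add_mono)
  finally show "(\<Sum>k<n. \<bar>(x - y) k\<bar>) \<le> s + 2 / real (Suc m)"
    using s by simp
qed

text \<open>On the octahedron the norm topology is the topology of coordinatewise convergence, for which
  compactness is Tychonoff's theorem.\<close>

lemma compactin_octahedron:
  assumes p: "1 \<le> p"
  shows "compactin (ell_topology p) octahedron"
proof -
  interpret Metric_space "ell p" "ell_dist p" by (rule Metric_space_ell[OF p])
  have "continuous_map (top_of_set octahedron) mtopology (\<lambda>x. x)"
    unfolding continuous_map_to_metric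
  proof (intro ballI allI impI)
    fix x :: "nat \<Rightarrow> real" and \<epsilon> :: real
    assume "x \<in> topspace (top_of_set octahedron)" and e: "\<epsilon> > 0"
    then have x: "x \<in> octahedron" by simp
    \<comment> \<open>Half of \<epsilon> is reserved for the two tails, the other half for the first
      \<open>m\<close> coordinates.\<close>
    obtain m where "4 / \<epsilon> < real m"
      using reals_Archimedean2 by blast
    then have m: "2 / real (Suc m) < \<epsilon> / 2"
      using e by (simp add: field_simps)
    define U where "U = octahedron \<inter> {y. (\<Sum>k<m. \<bar>x k - y k\<bar>) < \<epsilon> / 2}"
    have "openin (top_of_set octahedron) U"
      unfolding U_def by (intro openin_open_Int open_Collect_less continuous_intros
          continuous_on_product_coordinates)
    moreover have "x \<in> U"
      using x e by (simp add: U_def)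
    moreover have "y \<in> mball x \<epsilon>" if "y \<in> U" for y
      using that m e octahedron_dist_le[OF p x, of y m "\<epsilon> / 2"] x octahedron_subset_ell[OF p]
      by (auto simp: U_def)
    ultimately show "\<exists>U. openin (top_of_set octahedron) U \<and> x \<in> U \<and> (\<forall>y\<in>U. y \<in> mball x \<epsilon>)"
      by blast
  qed
  from image_compactin[OF _ this, of octahedron] show ?thesis
    using compact_octahedron by (simp add: ell_topology_def compactin_subtopology)
qed

section \<open>The greedy algorithm on the octahedron\<close>

definition truncated :: "nat \<Rightarrow> (nat \<Rightarrow> real) set" where
  "truncated n = {x. \<forall>k\<ge>n. x k = 0}"

definition tail :: "nat \<Rightarrow> (nat \<Rightarrow> real) \<Rightarrow> nat \<Rightarrow> real" where
  "tail n x k = (if k < n then 0 else x k)"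

lemma truncated_subset_ell:
  assumes "1 \<le> p"
  shows "truncated n \<subseteq> ell p"
proof
  fix x assume x: "x \<in> truncated n"
  show "x \<in> ell p"
  proof (rule ell_norm_le_sum_abs(1)[OF assms])
    show "0 < 1 + (\<Sum>k<n. \<bar>x k\<bar>)"
      by (simp add: add_pos_nonneg sum_nonneg)
    fix m
    have "(\<Sum>k<m. \<bar>x k\<bar>) = (\<Sum>k\<in>{..<m} \<inter> {..<n}. \<bar>x k\<bar>)"
      using x by (intro sum.mono_neutral_right) (auto simp: truncated_def not_le[symmetric])
    also have "\<dots> \<le> (\<Sum>k<n. \<bar>x k\<bar>)"
      by (intro sum_mono2) auto
    finally show "(\<Sum>k<m. \<bar>x k\<bar>) \<le> 1 + (\<Sum>k<n. \<bar>x k\<bar>)" by simp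
  qed
qed

text \<open>Subtracting an element of the subspace leaves the tail untouched, and the norm is
  monotone in the absolute values, so cutting off the tail gives a best approximation for every
  \<open>p\<close>.\<close>

lemma ell_infdist_truncated:
  assumes p: "1 \<le> p" and x: "x \<in> ell p"
  shows "ell_infdist p x (truncated n) = ell_norm p (tail n x)"
  unfolding ell_infdist_def
proof (rule antisym)
  have "x - tail n x \<in> truncated n"
    by (simp add: truncated_def tail_def)
  moreover have "bdd_below ((\<lambda>g. ell_dist p x g) ` truncated n)"
    by (rule bdd_belowI2[of _ 0]) (simp add: ell_dist_def ell_norm_nonneg)
  ultimately show "(INF g\<in>truncated n. ell_dist p x g) \<le> ell_norm p (tail n x)"
    by (intro cINF_lower2) (auto simp: ell_dist_def)
next
  show "ell_norm p (tail n x) \<le> (INF g\<in>truncated n. ell_dist p x g)"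
  proof (rule cINF_greatest)
    have "0 \<in> truncated n" by (simp add: truncated_def)
    then show "truncated n \<noteq> {}" by auto
    fix g assume g: "g \<in> truncated n"
    then show "ell_norm p (tail n x) \<le> ell_dist p x g"
      unfolding ell_dist_def using truncated_subset_ell[OF p] x
      by (intro ell_norm_mono ell_diff p) (auto simp: truncated_def tail_def)
  qed
qed

lemma norm_tail_octahedron:
  assumes p: "1 \<le> p" and x: "x \<in> octahedron"
  shows "ell_norm p (tail n x) \<le> 1 / real (Suc n)"
proof (rule ell_norm_le_sum_abs(2)[OF p])
  fix m
  have "(\<Sum>k<m. \<bar>tail n x k\<bar>) = (\<Sum>k\<in>{n..<m}. \<bar>x k\<bar>)"
    by (intro sum.mono_neutral_cong_right) (auto simp: tail_def)
  then show "(\<Sum>k<m. \<bar>tail n x k\<bar>) \<le> 1 / real (Suc n)"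
    using octahedron_tail'[OF x] by simp
qed simp

definition vertex :: "nat \<Rightarrow> nat \<Rightarrow> real" where
  "vertex n = (\<lambda>k. if k = n then 1 / real (Suc n) else 0)"

lemma vertex_octahedron: "vertex n \<in> octahedron"
proof -
  have "(\<Sum>k<m. real (Suc k) * \<bar>vertex n k\<bar>) = (\<Sum>k<m. if k = n then 1 else 0)" for m
    by (rule sum.cong) (auto simp: vertex_def)
  then show ?thesis
    by (simp add: octahedron_def)
qed

lemma norm_tail_vertex:
  assumes p: "1 \<le> p"
  shows "ell_norm p (tail n (vertex n)) \<ge> 1 / real (Suc n)"
proof -
  have t: "tail n (vertex n) = vertex n"
    by (auto simp: tail_def vertex_def)
  show ?thesis
    using ell_norm_ge[OF p, of "vertex n" "1 / real (Suc n)" "{n}"]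
      vertex_octahedron octahedron_subset_ell[OF p] by (auto simp: t) (auto simp: vertex_def)
qed

text \<open>A nonzero coordinate beyond \<open>n\<close> carries a weight strictly above
  \<open>Suc n\<close>, which makes the tail norm strictly smaller than the maximum. This strictness
  determines the greedy spaces however ties are broken.\<close>

lemma norm_tail_octahedron_extremal:
  assumes p: "1 \<le> p" and x: "x \<in> octahedron"
    and ge: "1 / real (Suc n) \<le> ell_norm p (tail n x)"
  shows "x n \<noteq> 0" "x \<in> truncated (Suc n)"
proof -
  show trunc: "x \<in> truncated (Suc n)"
    unfolding truncated_def
  proof (intro CollectI allI impI)
    fix j assume j: "Suc n \<le> j"
    show "x j = 0"
    proof (rule ccontr)
      assume nz: "x j \<noteq> 0"
      \<comment> \<open>The weight of coordinate \<open>j\<close> exceeds \<open>Suc n\<close> by at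
        least 1, so \<open>j\<close> uses up an extra \<open>\<bar>x j\<bar>\<close> of the total
        budget 1; \<open>S\<close> bounds what remains for the tail sum.\<close>
      define S where "S = (1 - \<bar>x j\<bar>) / real (Suc n)"
      have j1: "real (Suc j) * \<bar>x j\<bar> \<le> 1"
        using octahedron_tail[OF x, of j "Suc j"] by simp
      have "\<bar>x j\<bar> < real (Suc j) * \<bar>x j\<bar>"
        using nz j by simp
      with j1 have S: "0 < S"
        by (simp add: S_def)
      have "ell_norm p (tail n x) \<le> S"
      proof (rule ell_norm_le_sum_abs(2)[OF p S])
        fix m
        \<comment> \<open>Lengthening the range makes it contain \<open>j\<close>, so that the
          saving at \<open>j\<close> enters the sum.\<close>
        define l where "l = max m (Suc j)"
        have "real (Suc n) * (\<Sum>k\<in>{n..<l}. \<bar>x k\<bar>) + \<bar>x j\<bar>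
            = (\<Sum>k\<in>{n..<l}. real (Suc n) * \<bar>x k\<bar> + (if k = j then \<bar>x k\<bar> else 0))"
          using j by (simp add: sum.distrib sum_distrib_left l_def)
        also have "\<dots> \<le> (\<Sum>k\<in>{n..<l}. real (Suc k) * \<bar>x k\<bar>)"
        proof (rule sum_mono)
          fix k assume k: "k \<in> {n..<l}"
          have "real (Suc n) + (if k = j then 1 else 0) \<le> real (Suc k)"
            using k j by auto
          from mult_right_mono[OF this, of "\<bar>x k\<bar>"]
          show "real (Suc n) * \<bar>x k\<bar> + (if k = j then \<bar>x k\<bar> else 0) \<le> real (Suc k) * \<bar>x k\<bar>"
            by (auto simp: algebra_simps)
        qed
        also have "\<dots> \<le> (\<Sum>k<l. real (Suc k) * \<bar>x k\<bar>)"
          by (intro sum_mono2) auto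
        also have "\<dots> \<le> 1"
          by (rule octahedronD[OF x])
        finally have 1: "(\<Sum>k\<in>{n..<l}. \<bar>x k\<bar>) \<le> S"
          by (simp add: S_def field_simps)
        have "(\<Sum>k<m. \<bar>tail n x k\<bar>) = (\<Sum>k\<in>{n..<m}. \<bar>x k\<bar>)"
          by (intro sum.mono_neutral_cong_right) (auto simp: tail_def)
        also have "\<dots> \<le> (\<Sum>k\<in>{n..<l}. \<bar>x k\<bar>)"
          by (intro sum_mono2) (auto simp: l_def)
        finally show "(\<Sum>k<m. \<bar>tail n x k\<bar>) \<le> S"
          using 1 by simp
      qed
      also have "S < 1 / real (Suc n)"
        using nz by (simp add: S_def divide_strict_right_mono)
      finally show False using ge by simp
    qed
  qed
  show "x n \<noteq> 0"
  proof
    assume "x n = 0"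
    then have "tail n x = 0"
      using trunc by (auto simp: fun_eq_iff tail_def truncated_def) (metis not_less_less_Suc_eq not_less)
    then show False
      using ge ell_zero[OF p] by simp
  qed
qed

text \<open>The multiple \<open>y n / x n\<close> of \<open>x\<close> cancels coordinate
  \<open>n\<close> of \<open>y\<close>. The left side has the form produced by
  \<open>span_insert\<close>.\<close>

lemma span_insert_truncated:
  assumes "x n \<noteq> 0" "x \<in> truncated (Suc n)"
  shows "{y. \<exists>c. y - c *\<^sub>R x \<in> truncated n} = truncated (Suc n)"
proof (intro set_eqI iffI)
  fix y assume "y \<in> {y. \<exists>c. y - c *\<^sub>R x \<in> truncated n}"
  then obtain c where c: "\<And>k. k \<ge> n \<Longrightarrow> y k - c * x k = 0"
    by (auto simp: truncated_def scaleR_fun_def)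
  show "y \<in> truncated (Suc n)"
    unfolding truncated_def
  proof (intro CollectI allI impI)
    fix k assume "Suc n \<le> k"
    then show "y k = 0"
      using c[of k] assms(2) by (simp add: truncated_def)
  qed
next
  fix y assume y: "y \<in> truncated (Suc n)"
  have "y - (y n / x n) *\<^sub>R x \<in> truncated n"
    unfolding truncated_def
  proof (intro CollectI allI impI)
    fix k assume "n \<le> k"
    then show "(y - (y n / x n) *\<^sub>R x) k = 0"
      using y assms by (cases "k = n") (auto simp: truncated_def scaleR_fun_def)
  qed
  then show "y \<in> {y. \<exists>c. y - c *\<^sub>R x \<in> truncated n}" by blast
qed

text \<open>By induction. Comparing the maximizer with \<open>vertex n\<close> makes it extremal, so
  modulo the previous space it is a nonzero multiple of the \<open>n\<close>-th axis vector.\<close>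

lemma greedy_space_octahedron:
  assumes p: "1 \<le> p" and run: "greedy_run p octahedron f"
  shows "greedy_space f n = truncated n"
proof (induction n)
  case 0
  show ?case by (auto simp: greedy_space_def truncated_def)
next
  case (Suc n)
  have "is_arg_max (\<lambda>g. ell_infdist p g (truncated n)) (\<lambda>g. g \<in> octahedron) (f (Suc n))"
    using run Suc by (auto simp: greedy_run_def dest!: spec[of _ "Suc n"])
  then have f: "f (Suc n) \<in> octahedron"
    and "ell_infdist p (vertex n) (truncated n) \<le> ell_infdist p (f (Suc n)) (truncated n)"
    using vertex_octahedron[of n] by (auto simp: is_arg_max_linorder)
  then have "1 / real (Suc n) \<le> ell_norm p (tail n (f (Suc n)))"
    using norm_tail_vertex[OF p, of n] vertex_octahedron[of n] octahedron_subset_ell[OF p]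
    by (simp add: ell_infdist_truncated[OF p] subset_eq)
  note ex = norm_tail_octahedron_extremal[OF p f this]
  have "greedy_space f (Suc n) = {y. \<exists>c. y - c *\<^sub>R f (Suc n) \<in> greedy_space f n}"
    by (simp add: greedy_space_def atLeastAtMostSuc_conv span_insert)
  then show ?case
    using span_insert_truncated[of "f (Suc n)", OF ex] Suc by simp
qed

lemma greedy_error_octahedron:
  assumes p: "1 \<le> p" and run: "greedy_run p octahedron f"
  shows "greedy_error p octahedron f n = 1 / real (Suc n)"
proof -
  have "greedy_error p octahedron f n = (SUP g\<in>octahedron. ell_norm p (tail n g))"
    using octahedron_subset_ell[OF p]
    by (auto simp: greedy_error_def greedy_space_octahedron[OF p run] ell_infdist_truncated[OF p]
        intro!: SUP_cong)
  also have "\<dots> = 1 / real (Suc n)"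
  proof (rule antisym)
    show "(SUP g\<in>octahedron. ell_norm p (tail n g)) \<le> 1 / real (Suc n)"
      using vertex_octahedron norm_tail_octahedron[OF p] by (intro cSUP_least) auto
    show "1 / real (Suc n) \<le> (SUP g\<in>octahedron. ell_norm p (tail n g))"
      using norm_tail_octahedron[OF p] norm_tail_vertex[OF p] vertex_octahedron
      by (intro cSUP_upper2[of _ _ "vertex n"] bdd_aboveI2) auto
  qed
  finally show ?thesis .
qed

section \<open>Upper bound for the entropy numbers\<close>

lemma inverse_ereal_bounds:
  assumes "1 \<le> p"
  shows "0 \<le> real_of_ereal (1 / p)" "real_of_ereal (1 / p) \<le> 1"
  using assms by (auto elim!: ereal_exponent_cases) (auto simp: one_ereal_def)

text \<open>The finite sum has a closed form, proved by induction, whose negative term is dropped.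
  It is the factor of one coordinate in the generating function of signed partitions.\<close>

lemma sum_geometric_symmetric:
  fixes y :: real
  assumes "0 \<le> y" "y < 1"
  shows "(\<Sum>z\<in>{- int b..int b}. y ^ nat \<bar>z\<bar>) \<le> (1 + y) / (1 - y)"
proof -
  have "(\<Sum>z\<in>{- int b..int b}. y ^ nat \<bar>z\<bar>) = (1 + y - 2 * y ^ Suc b) / (1 - y)"
  proof (induction b)
    case 0
    then show ?case using assms by simp
  next
    case (Suc b)
    have "{- int (Suc b)..int (Suc b)} = insert (- int (Suc b)) (insert (int (Suc b)) {- int b..int b})"
      by auto
    then have "(\<Sum>z\<in>{- int (Suc b)..int (Suc b)}. y ^ nat \<bar>z\<bar>)
        = 2 * y ^ Suc b + (1 + y - 2 * y ^ Suc b) / (1 - y)"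
      by (simp add: Suc nat_add_distrib)
    then show ?case
      using assms by (simp add: field_simps)
  qed
  then show ?thesis
    using assms by (simp add: divide_right_mono)
qed

text \<open>The left side is the hyperbolic cotangent of \<open>t / 2\<close>. Keeping only the
  quadratic term of \<open>exp t - 1\<close> gives it the shape of a factor in Euler's
  product.\<close>

lemma coth_le:
  fixes t :: real
  assumes "0 < t"
  shows "(1 + exp (- t)) / (1 - exp (- t)) \<le> 1 + 4 / t\<^sup>2"
proof -
  define e where "e = exp t"
  have e: "e - 1 \<ge> t\<^sup>2 / 2"
    using exp_lower_Taylor_quadratic[of t] assms by (simp add: e_def)
  have t2: "t\<^sup>2 / 2 > 0" using assms by simp
  have "(1 + exp (- t)) / (1 - exp (- t)) = 1 + 2 / (e - 1)"
    using e t2 by (simp add: e_def exp_minus field_simps)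
  also have "2 / (e - 1) \<le> 2 / (t\<^sup>2 / 2)"
    using e t2 by (intro divide_left_mono mult_pos_pos) linarith+
  finally show ?thesis by simp
qed

text \<open>Euler's product for the sine at the imaginary point \<open>\<i> u\<close>.\<close>

lemma prod_one_plus_le_exp:
  fixes u :: real
  assumes u: "0 < u"
  shows "(\<Prod>k=1..n. 1 + u\<^sup>2 / (real k)\<^sup>2) \<le> exp (pi * u)"
proof -
  define P where "P n = (\<Prod>k=1..n. 1 + u\<^sup>2 / (real k)\<^sup>2)" for n
  have P0: "0 \<le> P n" for n
    by (auto simp: P_def intro!: prod_nonneg)
  have inc: "incseq P"
    by (rule incseq_SucI) (use P0 in \<open>simp add: P_def distrib_left\<close>)
  have "(\<lambda>n. of_real pi * (\<i> * of_real u) * (\<Prod>k=1..n. 1 - (\<i> * of_real u)\<^sup>2 / (of_nat k)\<^sup>2))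
      = (\<lambda>n. \<i> * of_real (pi * u * P n))"
    by (simp add: P_def power_mult_distrib fun_eq_iff)
  with sin_product_formula_complex[of "\<i> * of_real u"]
  have "(\<lambda>n. \<i> * of_real (pi * u * P n)) \<longlonglongrightarrow> sin (of_real pi * (\<i> * of_real u))"
    by simp
  from tendsto_norm[OF this]
  have "(\<lambda>n. pi * u * P n) \<longlonglongrightarrow> norm (sin (\<i> * of_real (pi * u)))"
    using u P0 by (simp add: norm_mult abs_mult mult_ac)
  also have "sin (\<i> * of_real (pi * u)) = \<i> * of_real ((exp (pi * u) - exp (- (pi * u))) / 2)"
    unfolding sin_i_times by (simp add: exp_minus flip: exp_of_real)
  also have "norm \<dots> = (exp (pi * u) - exp (- (pi * u))) / 2"
    using u by (simp only: norm_mult norm_ii norm_of_real) simp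
  finally have lim: "(\<lambda>n. pi * u * P n) \<longlonglongrightarrow> (exp (pi * u) - exp (- (pi * u))) / 2" .
  \<comment> \<open>The partial products increase to their limit, so each of them lies below
    it.\<close>
  have "incseq (\<lambda>n. pi * u * P n)"
    using inc u by (auto simp: incseq_def intro!: mult_left_mono)
  then have "pi * u * P n \<le> (exp (pi * u) - exp (- (pi * u))) / 2"
    using lim by (rule incseq_le)
  also have "\<dots> = exp (pi * u) * (1 - exp (- 2 * (pi * u))) / 2"
    by (simp add: algebra_simps flip: exp_add)
  \<comment> \<open>The estimate \<open>1 - exp (- s) \<le> s\<close> with
    \<open>s = 2 * (pi * u)\<close> produces the factor \<open>pi * u\<close> to be
    cancelled.\<close>
  also have "\<dots> \<le> exp (pi * u) * (2 * (pi * u)) / 2"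
    using exp_ge_add_one_self[of "- 2 * (pi * u)"] by (intro divide_right_mono mult_left_mono) auto
  finally show ?thesis
    using u by (simp add: P_def mult_ac)
qed

text \<open>The points counted here are signed partitions of numbers up to \<open>M\<close>. Each term of their
  generating function at \<open>exp (- t)\<close> is at least \<open>exp (- t * M)\<close>.\<close>

lemma card_signed_partitions_le:
  fixes t M :: real
  assumes t: "0 < t"
  shows "real (card {z \<in> {..<l} \<rightarrow>\<^sub>E {- int b..int b}. (\<Sum>k<l. real (Suc k) * \<bar>real_of_int (z k)\<bar>) \<le> M})
    \<le> exp (t * M + 2 * pi / t)" (is "real (card ?Z) \<le> _")
proof -
  let ?E = "{..<l} \<rightarrow>\<^sub>E {- int b..int b}"
  let ?y = "\<lambda>k. exp (- (t * real (Suc k)))"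
  have fin: "finite ?E" by (intro finite_PiE) auto
  have "real (card ?Z) * exp (- (t * M)) = (\<Sum>z\<in>?Z. exp (- (t * M)))"
    by simp
  also have "\<dots> \<le> (\<Sum>z\<in>?Z. \<Prod>k<l. ?y k ^ nat \<bar>z k\<bar>)"
  proof (rule sum_mono)
    fix z assume z: "z \<in> ?Z"
    have "exp (- (t * M)) \<le> exp (- (t * (\<Sum>k<l. real (Suc k) * \<bar>real_of_int (z k)\<bar>)))"
      using z t by (auto intro!: mult_left_mono)
    also have "\<dots> = (\<Prod>k<l. ?y k ^ nat \<bar>z k\<bar>)"
      by (simp add: sum_distrib_left sum_negf[symmetric] exp_sum exp_of_nat_mult[symmetric] mult_ac
        del: of_nat_Suc)
    finally show "exp (- (t * M)) \<le> (\<Prod>k<l. ?y k ^ nat \<bar>z k\<bar>)" .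
  qed
  \<comment> \<open>Passing to the whole box lets the sum factor over the coordinates.\<close>
  also have "\<dots> \<le> (\<Sum>z\<in>?E. \<Prod>k<l. ?y k ^ nat \<bar>z k\<bar>)"
    using fin by (intro sum_mono2 prod_nonneg) auto
  also have "\<dots> = (\<Prod>k<l. \<Sum>z\<in>{- int b..int b}. ?y k ^ nat \<bar>z\<bar>)"
    by (rule prod_sum_PiE[symmetric]) auto
  also have "\<dots> \<le> (\<Prod>k<l. 1 + (2 / t)\<^sup>2 / (real (Suc k))\<^sup>2)"
  proof (rule prod_mono, intro conjI)
    fix k
    show "0 \<le> (\<Sum>z\<in>{- int b..int b}. ?y k ^ nat \<bar>z\<bar>)"
      by (intro sum_nonneg) auto
    have "(\<Sum>z\<in>{- int b..int b}. ?y k ^ nat \<bar>z\<bar>) \<le> (1 + ?y k) / (1 - ?y k)"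
      using t by (intro sum_geometric_symmetric) auto
    also have "\<dots> \<le> 1 + 4 / (t * real (Suc k))\<^sup>2"
      using t by (intro coth_le) auto
    finally show "(\<Sum>z\<in>{- int b..int b}. ?y k ^ nat \<bar>z\<bar>) \<le> 1 + (2 / t)\<^sup>2 / (real (Suc k))\<^sup>2"
      by (simp add: power_divide power_mult_distrib)
  qed
  also have "\<dots> = (\<Prod>k=1..l. 1 + (2 / t)\<^sup>2 / (real k)\<^sup>2)"
    by (rule prod.reindex_bij_witness[of _ "\<lambda>k. k - 1" Suc]) auto
  also have "\<dots> \<le> exp (pi * (2 / t))"
    using t by (intro prod_one_plus_le_exp) auto
  finally have "real (card ?Z) * exp (- (t * M)) * exp (t * M) \<le> exp (pi * (2 / t)) * exp (t * M)"
    by (intro mult_right_mono) auto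
  then show ?thesis
    by (simp add: mult.assoc flip: exp_add) (simp add: mult_ac add_ac)
qed

text \<open>Rounding towards zero never increases the absolute value, so rounded points keep the
  weighted sum bound of the octahedron.\<close>

definition round_to_zero :: "real \<Rightarrow> int" where
  "round_to_zero a = (if 0 \<le> a then \<lfloor>a\<rfloor> else \<lceil>a\<rceil>)"

lemma round_to_zero:
  "\<bar>real_of_int (round_to_zero a)\<bar> \<le> \<bar>a\<bar>"
  "\<bar>a - real_of_int (round_to_zero a)\<bar> \<le> 1"
  "\<bar>a - real_of_int (round_to_zero a)\<bar> \<le> \<bar>a\<bar>"
  unfolding round_to_zero_def by (simp_all split: if_splits) linarith+

text \<open>A point of the octahedron is rounded coordinatewise to the grid of mesh \<open>200 / n\<^sup>2\<close>. The error is
  at most the mesh on the first \<open>n\<close> coordinates and at most the point itself on the others, whose sum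
  is below \<open>1 / n\<close>.\<close>

lemma octahedron_cover:
  assumes p: "1 \<le> p" and n: "1 \<le> n"
  defines "r \<equiv> real_of_ereal (1 / p)"
  shows "\<exists>c. (\<forall>i<2^n. c i \<in> ell p) \<and>
    octahedron \<subseteq> (\<Union>i<(2::nat)^n. Metric_space.mcball (ell p) (ell_dist p) (c i) (400 * real n powr (r - 2)))"
proof -
  interpret Metric_space "ell p" "ell_dist p" by (rule Metric_space_ell[OF p])
  have r: "0 \<le> r" "r \<le> 1" unfolding r_def using p by (rule inverse_ereal_bounds)+
  \<comment> \<open>From coordinate \<open>N\<close> on, entries are at most
    \<open>1 / real N \<le> h\<close> and may be replaced by 0. The same \<open>N\<close> bounds the
    rounded entries, as \<open>1 / h \<le> real N\<close>.\<close>
  define N where "N = n\<^sup>2"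
  define h where "h = 200 / real N"
  have N: "real N > 0" "real N = (real n)\<^sup>2" using n by (auto simp: N_def)
  have h: "h > 0" "1 / h \<le> real N" "1 / real N \<le> h" using N by (auto simp: h_def field_simps)
  define Z where "Z = {z \<in> {..<N} \<rightarrow>\<^sub>E {- int N..int N}. (\<Sum>k<N. real (Suc k) * \<bar>real_of_int (z k)\<bar>) \<le> 1 / h}"
  have finZ: "finite Z"
    by (rule finite_subset[of _ "{..<N} \<rightarrow>\<^sub>E {- int N..int N}"]) (auto simp: Z_def intro!: finite_PiE)
  \<comment> \<open>The parameter \<open>t = 40 / real n\<close> is close to the minimizer of the
    exponent. The value below is at most \<open>2 / 5 * real n\<close>, as \<open>pi < 4\<close>,
    and \<open>ln 2\<close> is at least \<open>2 / 3\<close>.\<close>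
  have "real (card Z) \<le> exp (40 / real n * (1 / h) + 2 * pi / (40 / real n))"
    unfolding Z_def using n by (intro card_signed_partitions_le) auto
  also have "40 / real n * (1 / h) + 2 * pi / (40 / real n) = real n * (1 / 5 + pi / 20)"
    using n by (simp add: h_def N field_simps power2_eq_square)
  also have "exp \<dots> \<le> exp (real n * ln 2)"
    using pi_less_4 ln2_ge_two_thirds by (intro iffD2[OF exp_le_cancel_iff] mult_left_mono) auto
  also have "\<dots> = 2 ^ n"
    by (simp add: exp_of_nat_mult)
  finally have "real (card Z) \<le> real (2 ^ n)" by simp
  then have cardZ: "card Z \<le> 2 ^ n" by (simp only: of_nat_le_iff)
  obtain g where g: "bij_betw g {0..<card Z} Z"
    using ex_bij_betw_nat_finite[OF finZ] by blast
  define c :: "(nat \<Rightarrow> int) \<Rightarrow> nat \<Rightarrow> real" where "c z k = (if k < N then h * z k else 0)" for z k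
  \<comment> \<open>For all \<open>z\<close>, because \<open>g i\<close> is arbitrary at indices
    from \<open>card Z\<close> up to \<open>2 ^ n\<close>.\<close>
  have c: "c z \<in> ell p" for z
    using truncated_subset_ell[OF p, of N] by (auto simp: truncated_def c_def)
  have near: "\<exists>z\<in>Z. ell_dist p (c z) x \<le> 400 * real n powr (r - 2)" if x: "x \<in> octahedron" for x
  proof
    define z where "z = (\<lambda>k\<in>{..<N}. round_to_zero (x k / h))"
    have zx: "\<bar>real_of_int (z k)\<bar> \<le> \<bar>x k\<bar> / h" if "k < N" for k
      using round_to_zero(1)[of "x k / h"] that h by (simp add: z_def)
    have x1: "\<bar>x k\<bar> \<le> 1 / real (Suc k)" for k
      using octahedron_tail'[OF x, of k "Suc k"] by simp
    have "z \<in> {..<N} \<rightarrow>\<^sub>E {- int N..int N}"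
    proof (rule PiE_I)
      fix k assume k: "k \<in> {..<N}"
      have "\<bar>x k\<bar> \<le> 1"
        using x1[of k] order_trans[of "\<bar>x k\<bar>" "1 / real (Suc k)" 1] by simp
      then have "\<bar>x k\<bar> / h \<le> 1 / h"
        using h by (intro divide_right_mono) auto
      then have "\<bar>real_of_int (z k)\<bar> \<le> real N"
        using zx[of k] k h by simp
      then have "\<bar>z k\<bar> \<le> int N" by linarith
      then show "z k \<in> {- int N..int N}" by auto
    qed (simp add: z_def)
    moreover have "(\<Sum>k<N. real (Suc k) * \<bar>real_of_int (z k)\<bar>) \<le> (\<Sum>k<N. real (Suc k) * (\<bar>x k\<bar> / h))"
      using zx by (intro sum_mono mult_left_mono) auto
    moreover have "\<dots> = (\<Sum>k<N. real (Suc k) * \<bar>x k\<bar>) / h"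
      by (simp add: sum_divide_distrib)
    moreover have "\<dots> \<le> 1 / h"
      using octahedronD[OF x] h by (intro divide_right_mono) auto
    ultimately show "z \<in> Z" by (simp add: Z_def)

    define d where "d = x - c z"
    have d: "\<bar>d k\<bar> \<le> h" "\<bar>d k\<bar> \<le> \<bar>x k\<bar>" for k
    proof -
      have "\<bar>d k\<bar> \<le> h \<and> \<bar>d k\<bar> \<le> \<bar>x k\<bar>"
      proof (cases "k < N")
        case True
        have "\<bar>d k\<bar> = h * \<bar>x k / h - real_of_int (z k)\<bar>"
          using h True by (simp add: d_def c_def abs_mult_pos' right_diff_distrib)
        moreover have "\<dots> \<le> h * 1"
          using round_to_zero(2)[of "x k / h"] True h by (intro mult_left_mono) (auto simp: z_def)
        moreover have "h * \<bar>x k / h - real_of_int (z k)\<bar> \<le> h * \<bar>x k / h\<bar>"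
          using round_to_zero(3)[of "x k / h"] True h by (intro mult_left_mono) (auto simp: z_def)
        ultimately show ?thesis using h by (simp add: abs_mult)
      next
        case False
        then have "real N \<le> real (Suc k)"
          by simp
        then have "1 / real (Suc k) \<le> 1 / real N"
          using N(1) by (intro divide_left_mono) auto
        then show ?thesis
          using x1[of k] h False by (simp add: d_def c_def)
      qed
      then show "\<bar>d k\<bar> \<le> h" "\<bar>d k\<bar> \<le> \<bar>x k\<bar>" by auto
    qed
    have "(\<Sum>k<m. \<bar>d k\<bar>) \<le> 2 * real n * h" for m
    proof -
      have "(\<Sum>k<m. \<bar>d k\<bar>) \<le> (\<Sum>k\<in>{..<n} \<union> {n..<m}. \<bar>d k\<bar>)"
        by (intro sum_mono2) auto
      also have "\<dots> = (\<Sum>k<n. \<bar>d k\<bar>) + (\<Sum>k\<in>{n..<m}. \<bar>d k\<bar>)"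
        by (rule sum.union_disjoint) auto
      also have "\<dots> \<le> (\<Sum>k<n. h) + (\<Sum>k\<in>{n..<m}. \<bar>x k\<bar>)"
        using d by (intro add_mono sum_mono)
      also have "\<dots> \<le> real n * h + 1 / real (Suc n)"
        using octahedron_tail'[OF x, of n m] by simp
      also have "1 / real (Suc n) \<le> real n * h"
        using n by (simp add: h_def N field_simps power2_eq_square)
      finally show ?thesis by (simp add: mult_ac)
    qed
    \<comment> \<open>Interpolation between the sup bound \<open>h\<close> and the sum bound
      \<open>2 * real n * h\<close>.\<close>
    then have "ell_norm p d \<le> h powr (1 - r) * (2 * real n * h) powr r"
      unfolding r_def using d h n by (intro ell_norm_interpolation p) auto
    also have "\<dots> = h * (2 powr r * real n powr r)"
      using h n by (simp add: powr_mult powr_diff)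
    also have "\<dots> \<le> h * (2 powr 1 * real n powr r)"
      using r h by (intro mult_left_mono mult_right_mono powr_mono) auto
    also have "\<dots> = 400 * real n powr (r - 2)"
      using n by (simp add: h_def N powr_diff)
    finally show "ell_dist p (c z) x \<le> 400 * real n powr (r - 2)"
      using commute[of "c z" x] by (simp only: ell_dist_def d_def)
  qed
  have "octahedron \<subseteq> (\<Union>i<2 ^ n. mcball (c (g i)) (400 * real n powr (r - 2)))"
  proof
    fix x assume x: "x \<in> octahedron"
    then obtain z where z: "z \<in> Z" "ell_dist p (c z) x \<le> 400 * real n powr (r - 2)"
      using near by blast
    have "z \<in> g ` {0..<card Z}"
      using z(1) g by (simp add: bij_betw_def)
    then obtain i where i: "i < card Z" "z = g i"
      by auto
    have "x \<in> mcball (c (g i)) (400 * real n powr (r - 2))"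
      using z(2) c[of z] x octahedron_subset_ell[OF p] unfolding i(2) in_mcball by blast
    moreover have "i \<in> {..<2 ^ n}"
      using i(1) cardZ unfolding lessThan_iff by (rule less_le_trans)
    ultimately show "x \<in> (\<Union>i<2 ^ n. mcball (c (g i)) (400 * real n powr (r - 2)))"
      by (rule UN_I[rotated])
  qed
  with c show ?thesis
    by (intro exI[of _ "\<lambda>i. c (g i)"]) simp
qed

section \<open>Lower bound for the entropy numbers\<close>

text \<open>Give each subset \<open>D\<close> the weight \<open>(1/2) ^ card D\<close>. Small sets
  weigh at least \<open>(1/2) ^ n\<close>, and all subsets together weigh
  \<open>(1 + 1/2) ^ N\<close> by the binomial expansion.\<close>

lemma card_small_subsets_le:
  fixes n N :: nat
  shows "real (card {D. D \<subseteq> {..<N} \<and> card D < n}) \<le> (3/2) ^ N * 2 ^ n"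
proof -
  let ?H = "{D. D \<subseteq> {..<N} \<and> card D < n}"
  have "real (card ?H) * (1/2) ^ n = (\<Sum>D\<in>?H. (1/2) ^ n)"
    by simp
  also have "\<dots> \<le> (\<Sum>D\<in>?H. (1/2) ^ card D)"
    by (intro sum_mono power_decreasing) auto
  also have "\<dots> \<le> (\<Sum>D\<in>Pow {..<N}. (1/2) ^ card D)"
    by (intro sum_mono2) auto
  also have "\<dots> = (3/2) ^ N"
    using prod_add[of "{..<N}" "\<lambda>_. 1/2 :: real" "\<lambda>_. 1"] by simp
  finally show ?thesis
    by (simp add: field_simps power_divide)
qed

text \<open>Pigeonhole: the \<open>2 ^ N\<close> scaled 0-1 vectors are distributed over
  \<open>2 ^ n\<close> balls, and too small a radius leaves too few of them in each ball.\<close>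

lemma octahedron_cover_radius_ge:
  assumes p: "1 \<le> p" and n: "1 \<le> n" and e: "0 < \<epsilon>"
  defines "r \<equiv> real_of_ereal (1 / p)"
  assumes cover: "octahedron \<subseteq> (\<Union>i<(2::nat)^n. Metric_space.mcball (ell p) (ell_dist p) (c i) \<epsilon>)"
  shows "real n powr (r - 2) / 128 \<le> \<epsilon>"
proof (rule ccontr)
  interpret Metric_space "ell p" "ell_dist p" by (rule Metric_space_ell[OF p])
  assume "\<not> real n powr (r - 2) / 128 \<le> \<epsilon>"
  then have small: "2 * \<epsilon> < real n powr (r - 2) / 64" by simp
  have r: "0 \<le> r" unfolding r_def using p by (rule inverse_ereal_bounds)
  \<comment> \<open>The factor 8 makes \<open>(4/3) ^ 8\<close> exceed 4, which the final count
    needs. With \<open>t\<close> as below, \<open>N\<close> weights of size at most \<open>N\<close>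
    cost at most \<open>N * N * t = 1\<close>.\<close>
  define N where "N = 8 * n"
  define t where "t = 1 / (real N)\<^sup>2"
  have t: "t > 0" and t_eq: "t * real n powr r = real n powr (r - 2) / 64"
    using n by (auto simp: t_def N_def powr_diff power_mult_distrib)
  define y :: "nat set \<Rightarrow> nat \<Rightarrow> real" where "y B k = (if k \<in> B then t else 0)" for B k
  have y: "y B \<in> octahedron" if B: "B \<subseteq> {..<N}" for B
    unfolding octahedron_def
  proof (intro CollectI allI)
    fix m
    have "(\<Sum>k<m. real (Suc k) * \<bar>y B k\<bar>) = (\<Sum>k\<in>{..<m} \<inter> B. real (Suc k) * \<bar>y B k\<bar>)"
      by (intro sum.mono_neutral_right) (auto simp: y_def)
    also have "\<dots> \<le> (\<Sum>k<N. real (Suc k) * \<bar>y B k\<bar>)"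
      using B by (intro sum_mono2) auto
    also have "\<dots> \<le> (\<Sum>k<N. real N * t)"
      using t by (intro sum_mono mult_mono) (auto simp: y_def)
    also have "\<dots> = 1"
      using n by (simp add: t_def N_def power2_eq_square)
    finally show "(\<Sum>k<m. real (Suc k) * \<bar>y B k\<bar>) \<le> 1" .
  qed
  \<comment> \<open>Balls may overlap, so one ball is chosen for each set.\<close>
  have "\<exists>i. \<forall>B\<in>Pow {..<N}. i B < 2 ^ n \<and> y B \<in> mcball (c (i B)) \<epsilon>"
    using cover y by (intro bchoice) blast
  then obtain i where i: "\<And>B. B \<subseteq> {..<N} \<Longrightarrow> i B < 2 ^ n \<and> y B \<in> mcball (c (i B)) \<epsilon>"
    by auto
  let ?H = "{D. D \<subseteq> {..<N} \<and> card D < n}"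
  have close: "sym_diff A B \<in> ?H" if A: "A \<subseteq> {..<N}" and B: "B \<subseteq> {..<N}" and eq: "i A = i B" for A B
  proof (rule ccontr)
    assume "sym_diff A B \<notin> ?H"
    with A B have card: "n \<le> card (sym_diff A B)" by auto
    have fin: "finite (sym_diff A B)"
      using A B by (meson finite_Diff finite_UnI finite_lessThan finite_subset)
    have "t * real n powr r \<le> t * real (card (sym_diff A B)) powr r"
      using t r card by (intro mult_left_mono powr_mono2) auto
    also have "\<dots> \<le> ell_norm p (y A - y B)"
      unfolding r_def
    proof (rule ell_norm_ge[OF p _ t fin])
      show "y A - y B \<in> ell p"
        using y[OF A] y[OF B] octahedron_subset_ell[OF p] by (intro ell_diff p) auto
      show "sym_diff A B \<noteq> {}" using card n by (metis card.empty not_one_le_zero le_trans)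
    qed (use t in \<open>auto simp: y_def\<close>)
    also have "\<dots> \<le> ell_dist p (y A) (c (i A)) + ell_dist p (c (i A)) (y B)"
      using triangle[of "y A" "c (i A)" "y B"] i[OF A] i[OF B] eq by (simp add: ell_dist_def)
    also have "\<dots> \<le> 2 * \<epsilon>"
      using i[OF A] i[OF B] eq commute[of "y A" "c (i A)"] by simp
    finally show False
      using small t_eq by simp
  qed
  have fibre: "card {B \<in> Pow {..<N}. i B = j} \<le> card ?H" for j
  proof (cases "{B \<in> Pow {..<N}. i B = j} = {}")
    case False
    then obtain A where A: "A \<subseteq> {..<N}" "i A = j" by auto
    \<comment> \<open>Symmetric difference with a fixed \<open>A\<close> is an involution, so a
      fibre has at most as many elements as there are small sets.\<close>
    have "inj_on (sym_diff A) {B \<in> Pow {..<N}. i B = j}"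
      by (rule inj_onI) blast
    moreover have "sym_diff A ` {B \<in> Pow {..<N}. i B = j} \<subseteq> ?H"
      using close A by blast
    ultimately show ?thesis
      by (rule card_inj_on_le) (auto intro: finite_subset[of _ "Pow {..<N}"])
  qed (metis card.empty le0)
  have "Pow {..<N} \<subseteq> (\<Union>j<2 ^ n. {B \<in> Pow {..<N}. i B = j})"
    using i by auto
  then have "card (Pow {..<N}) \<le> card (\<Union>j<2 ^ n. {B \<in> Pow {..<N}. i B = j})"
    by (intro card_mono) auto
  also have "\<dots> \<le> (\<Sum>j<2 ^ n. card {B \<in> Pow {..<N}. i B = j})"
    by (rule card_UN_le) simp
  also have "\<dots> \<le> (\<Sum>j<(2::nat) ^ n. card ?H)"
    using fibre by (intro sum_mono)
  finally have "2 ^ N \<le> 2 ^ n * card ?H"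
    by (simp add: card_Pow)
  then have "real (2 ^ N) \<le> real (2 ^ n * card ?H)"
    by (simp only: of_nat_le_iff)
  also have "\<dots> = 2 ^ n * real (card ?H)"
    by simp
  also have "\<dots> \<le> 2 ^ n * ((3/2) ^ N * 2 ^ n)"
    by (intro mult_left_mono card_small_subsets_le) auto
  finally have "(2 ^ 8) ^ n \<le> (2 * ((3/2) ^ 8 * 2) :: real) ^ n"
    unfolding N_def power_mult by (simp only: power_mult_distrib mult_ac of_nat_power of_nat_numeral)
  \<comment> \<open>The left base is about 102.5, the right one 256.\<close>
  moreover have "(2 * ((3/2) ^ 8 * 2) :: real) ^ n < (2 ^ 8) ^ n"
    using n by (intro power_strict_mono) (auto simp: power_divide)
  ultimately show False by simp
qed

section \<open>Entropy numbers and comparison of the rates\<close>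

lemma entropy_number_octahedron:
  assumes p: "1 \<le> p" and n: "1 \<le> n"
  shows "entropy_number p octahedron n \<le> 400 * real n powr (real_of_ereal (1 / p) - 2)"
    and "real n powr (real_of_ereal (1 / p) - 2) / 128 \<le> entropy_number p octahedron n"
proof -
  let ?E = "{\<epsilon>. \<epsilon> > 0 \<and> (\<exists>c. (\<forall>i<2^n. c i \<in> ell p) \<and>
     octahedron \<subseteq> (\<Union>i<(2::nat)^n. Metric_space.mcball (ell p) (ell_dist p) (c i) \<epsilon>))}"
  \<comment> \<open>This radius gives the upper bound and also shows that the infimum is over a
    nonempty set, as the lower bound requires.\<close>
  have mem: "400 * real n powr (real_of_ereal (1 / p) - 2) \<in> ?E"
    using octahedron_cover[OF p n] n by simp
  have "bdd_below ?E"
    by (rule bdd_belowI[of _ 0]) auto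
  with mem show "entropy_number p octahedron n \<le> 400 * real n powr (real_of_ereal (1 / p) - 2)"
    unfolding entropy_number_def by (rule cInf_lower)
  show "real n powr (real_of_ereal (1 / p) - 2) / 128 \<le> entropy_number p octahedron n"
    unfolding entropy_number_def
    by (rule cInf_greatest) (use mem octahedron_cover_radius_ge[OF p n] in blast)+
qed

theorem proposition3p1:
  fixes p :: ereal
  assumes "2 \<le> p"
  shows "\<exists>K :: (nat \<Rightarrow> real) set.
           compactin (ell_topology p) K \<and> convex K \<and> (\<forall>x\<in>K. - x \<in> K) \<and> K \<noteq> {} \<and> K \<noteq> {0} \<and>
           (\<exists>c>0. \<exists>C>0. \<forall>f. greedy_run p K f \<longrightarrow>
              (\<forall>n\<ge>1. c * real n powr (1 - real_of_ereal (1 / p)) * entropy_number p K n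
                        \<le> greedy_error p K f n \<and>
                      greedy_error p K f n
                        \<le> C * real n powr (1 - real_of_ereal (1 / p)) * entropy_number p K n))"
proof -
  have p: "1 \<le> p"
    using order_trans[of 1 2 p] assms by simp
  \<comment> \<open>The constant 800 is 400 times the loss 2 in
    \<open>1 / (2 * real n) \<le> 1 / real (Suc n)\<close>; 128 is the constant of the lower entropy
    bound.\<close>
  have bounds: "1 / 800 * real n powr (1 - real_of_ereal (1 / p)) * entropy_number p octahedron n
        \<le> greedy_error p octahedron f n \<and>
      greedy_error p octahedron f n
        \<le> 128 * real n powr (1 - real_of_ereal (1 / p)) * entropy_number p octahedron n"
    if run: "greedy_run p octahedron f" and n: "1 \<le> n" for f n
  proof
    define r where "r = real_of_ereal (1 / p)"
    have cancel: "real n powr (1 - r) * real n powr (r - 2) = 1 / real n"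
      using n by (simp add: powr_minus_divide flip: powr_add)
    have "1 / 800 * real n powr (1 - r) * entropy_number p octahedron n
        \<le> 1 / 800 * real n powr (1 - r) * (400 * real n powr (r - 2))"
      unfolding r_def by (rule mult_left_mono[OF entropy_number_octahedron(1)[OF p n]]) simp
    also have "\<dots> = 1 / 2 * (real n powr (1 - r) * real n powr (r - 2))"
      by simp
    also have "\<dots> = 1 / (2 * real n)"
      unfolding cancel by simp
    also have "\<dots> \<le> 1 / real (Suc n)"
      using n by (intro divide_left_mono) auto
    finally show "1 / 800 * real n powr (1 - real_of_ereal (1 / p)) * entropy_number p octahedron n
        \<le> greedy_error p octahedron f n"
      by (simp only: greedy_error_octahedron[OF p run] r_def)
    have "1 / real (Suc n) \<le> 1 / real n"
      using n by (intro divide_left_mono) auto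
    also have "\<dots> = 128 * real n powr (1 - r) * (real n powr (r - 2) / 128)"
      using cancel by simp
    also have "\<dots> \<le> 128 * real n powr (1 - r) * entropy_number p octahedron n"
      unfolding r_def by (rule mult_left_mono[OF entropy_number_octahedron(2)[OF p n]]) simp
    finally show "greedy_error p octahedron f n
        \<le> 128 * real n powr (1 - real_of_ereal (1 / p)) * entropy_number p octahedron n"
      by (simp only: greedy_error_octahedron[OF p run] r_def)
  qed
  have "octahedron \<noteq> {0}"
  proof
    assume "octahedron = {0}"
    then have "vertex 0 = 0"
      using vertex_octahedron[of 0] by blast
    from fun_cong[OF this, of 0] show False by (simp add: vertex_def)
  qed
  moreover have "octahedron \<noteq> {}"
    using vertex_octahedron by blast
  moreover have "\<exists>c>0. \<exists>C>0. \<forall>f. greedy_run p octahedron f \<longrightarrow>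
      (\<forall>n\<ge>1. c * real n powr (1 - real_of_ereal (1 / p)) * entropy_number p octahedron n
          \<le> greedy_error p octahedron f n \<and>
        greedy_error p octahedron f n
          \<le> C * real n powr (1 - real_of_ereal (1 / p)) * entropy_number p octahedron n)"
  proof (intro exI conjI allI impI)
    show "0 < (1 / 800 :: real)" "0 < (128 :: real)" by simp_all
  qed (use bounds in blast)+
  ultimately show ?thesis
    using compactin_octahedron[OF p] convex_octahedron octahedron_uminus by blast
qed

end
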